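(* The Hartogs triangle $\mathbf{T}=\{(z,w)\in\mathbf{C}^2 : |z|<|w|<1\}$ is a uniform domain.
   Context: We identify $\mathbf{C}^2$ with $\mathbf{R}^4$. Let $\Omega\subset\mathbf{R}^n$ be a domain with boundary $b\Omega$. For $\epsilon,\delta>0$ (with $\delta=\infty$ allowed), $\Omega$ is called an $(\epsilon,\delta)$ domain if for every $p_1\neq p_2$ in $\Omega$ with $|p_1-p_2|<\delta$ there is a rectifiable curve $\gamma$ contained in $\Omega$ joining $p_1$ and $p_2$ such that $\ell(\gamma)\le \frac{1}{\epsilon}|p_1-p_2|$ and $\mathrm{dist}(p,b\Omega)\ge \frac{\epsilon\,|p-p_1|\,|p-p_2|}{|p_1-p_2|}$ for all $p\in\gamma$. Here $\ell(\gamma)$ is the Euclidean length of $\gamma$ and $\mathrm{dist}(p,b\Omega)$ is the Euclidean distance from $p$ to $b\Omega$. $\Omega$ is called a uniform domain if it is an $(\epsilon,\infty)$ domain for some $\epsilon>0$. *)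

theory Defs
  imports "HOL-Analysis.Analysis"
begin

text \<open>The Euclidean space \<open>R^n\<close> is rendered by an arbitrary type of class
  \<^class>\<open>euclidean_space\<close>. Curves are paths of the library, parametrised by \<open>{0..1}\<close>.\<close>

definition is_domain :: "'a::euclidean_space set \<Rightarrow> bool" where
  "is_domain \<Omega> \<longleftrightarrow> open \<Omega> \<and> connected \<Omega> \<and> \<Omega> \<noteq> {}"

text \<open>The supremum of the lengths of inscribed polygons, over all subdivisions
  \<open>0 = t 0 \<le> t 1 \<le> \<dots> \<le> t n = 1\<close>.\<close>

definition curve_length :: "(real \<Rightarrow> 'a::metric_space) \<Rightarrow> ennreal" where
  "curve_length g =
    (SUP (n, t) \<in> {(n::nat, t::nat \<Rightarrow> real). t 0 = 0 \<and> t n = 1 \<and> mono_on {..n} t}.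
       ennreal (\<Sum>i<n. dist (g (t i)) (g (t (Suc i)))))"

definition rectifiable_curve :: "(real \<Rightarrow> 'a::metric_space) \<Rightarrow> bool" where
  "rectifiable_curve g \<longleftrightarrow> path g \<and> curve_length g < \<infinity>"

text \<open>If \<open>frontier \<Omega>\<close> is empty (the whole space), the distance to it is infinite and the
  distance condition is void. The guard is needed since \<^const>\<open>infdist\<close> to the empty set is \<open>0\<close>.\<close>

definition eps_delta_domain :: "real \<Rightarrow> ereal \<Rightarrow> 'a::euclidean_space set \<Rightarrow> bool" where
  "eps_delta_domain \<epsilon> \<delta> \<Omega> \<longleftrightarrow>
     0 < \<epsilon> \<and> 0 < \<delta> \<and> is_domain \<Omega> \<and>
     (\<forall>p1\<in>\<Omega>. \<forall>p2\<in>\<Omega>. p1 \<noteq> p2 \<and> ereal (dist p1 p2) < \<delta> \<longrightarrow>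
       (\<exists>g. rectifiable_curve g \<and> path_image g \<subseteq> \<Omega> \<and> pathstart g = p1 \<and> pathfinish g = p2 \<and>
          curve_length g \<le> ennreal (1 / \<epsilon> * dist p1 p2) \<and>
          (frontier \<Omega> \<noteq> {} \<longrightarrow>
            (\<forall>p\<in>path_image g.
               infdist p (frontier \<Omega>) \<ge> \<epsilon> * dist p p1 * dist p p2 / dist p1 p2))))"

definition uniform_domain :: "'a::euclidean_space set \<Rightarrow> bool" where
  "uniform_domain \<Omega> \<longleftrightarrow> (\<exists>\<epsilon>>0. eps_delta_domain \<epsilon> \<infinity> \<Omega>)"

text \<open>The product norm on \<^typ>\<open>complex \<times> complex\<close> is the Euclidean one,
  \<open>norm (z, w) = sqrt ((cmod z)\<^sup>2 + (cmod w)\<^sup>2)\<close>, so this type is \<open>C^2\<close> identified with \<open>R^4\<close>.\<close>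

definition hartogs_triangle :: "(complex \<times> complex) set" where
  "hartogs_triangle = {(z, w). cmod z < cmod w \<and> cmod w < 1}"

end

theory Submission
  imports Defs
begin

text \<open>
  The Hartogs triangle constrains \<open>z\<close> and \<open>|w|\<close> by convex conditions; what keeps it from
  being convex is only the argument of \<open>w\<close>, which is a free circle variable.
  Two points \<open>(z1, r1 e^(i a))\<close> and \<open>(z2, r2 e^(i (a + \<phi>)))\<close> with
  \<open>|\<phi>| \<le> \<pi>\<close> can therefore be joined by interpolating \<open>z\<close>, \<open>|w|\<close> and \<open>arg w\<close> linearly.
  Such a curve has length \<open>O(d)\<close>, where \<open>d\<close> is the distance of the points. For \<open>z\<close> and \<open>|w|\<close>
  this is clear; for the argument it holds because \<open>min r1 r2 * |\<phi>|\<close> is at most \<open>\<pi> / 2\<close> times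
  the chord \<open>|w1 - w2|\<close> (\<open>angle_le_dist\<close>), while the larger radius exceeds the smaller one by at
  most \<open>d\<close> and is multiplied by an angle of at most \<open>\<pi>\<close>.

  To keep away from the boundary, the pair \<open>(z, |w|)\<close> is in addition pulled towards
  \<open>(0, 1/2)\<close>, by the ratio \<open>s = d t (1 - t)\<close> at time \<open>t\<close>. Both
  \<open>|w| - |z|\<close> and \<open>1 - |w|\<close> are concave along this pull, nonnegative at its start and \<open>1/2\<close>
  at its centre, so they become at least \<open>s / 2\<close>, and the distance to the boundary at least
  \<open>s / 4\<close> (\<open>hartogs_triangle_infdist_frontier\<close>). The resulting curve is still
  \<open>10 d\<close>-Lipschitz (\<open>hartogs_triangle_curve\<close>); hence its length is at most \<open>10 d\<close>, and its point \<open>p\<close>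
  at time \<open>t\<close> satisfies \<open>|p - p1| |p - p2| / d \<le> 100 d t (1 - t)\<close>, which is \<open>400\<close> times the lower
  bound of the distance to the boundary. So \<open>\<epsilon> = 1/400\<close> will do.
\<close>

section \<open>Length of Lipschitz curves\<close>

lemma lipschitz_curve_length_le:
  assumes "L-lipschitz_on {0..1} g"
  shows "curve_length g \<le> ennreal L"
  unfolding curve_length_def
proof (rule SUP_least, clarify)
  fix n :: nat and t :: "nat \<Rightarrow> real"
  assume t: "t 0 = 0" "t n = 1" "mono_on {..n} t"
  have mono: "t i \<le> t j" if "i \<le> j" "j \<le> n" for i j
    using monotone_onD[OF t(3), of i j] that by auto
  have "(\<Sum>i<n. dist (g (t i)) (g (t (Suc i)))) \<le> (\<Sum>i<n. L * (t (Suc i) - t i))"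
  proof (rule sum_mono)
    fix i assume i: "i \<in> {..<n}"
    have "t i \<in> {0..1}" "t (Suc i) \<in> {0..1}"
      using mono[of 0 i] mono[of i n] mono[of 0 "Suc i"] mono[of "Suc i" n] t i by auto
    then have "dist (g (t i)) (g (t (Suc i))) \<le> L * dist (t i) (t (Suc i))"
      using assms by (auto dest: lipschitz_onD)
    then show "dist (g (t i)) (g (t (Suc i))) \<le> L * (t (Suc i) - t i)"
      using mono[of i "Suc i"] i by (simp add: dist_real_def)
  qed
  also have "\<dots> = L * (t n - t 0)"
    by (simp add: sum_lessThan_telescope flip: sum_distrib_left)
  finally show "ennreal (\<Sum>i<n. dist (g (t i)) (g (t (Suc i)))) \<le> ennreal L"
    using t by (auto intro!: ennreal_leI)
qed

lemma lipschitz_imp_rectifiable_curve: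
  assumes "L-lipschitz_on {0..1} g"
  shows "rectifiable_curve g"
proof -
  have "path g"
    unfolding path_def using assms by (rule lipschitz_on_continuous_on)
  then show ?thesis
    unfolding rectifiable_curve_def
    using lipschitz_curve_length_le[OF assms] by (auto intro: le_less_trans)
qed

section \<open>Chords and arcs of circles\<close>

lemma norm_cis_minus_one: "norm (cis x - 1) = 2 * \<bar>sin (x / 2)\<bar>"
  using dist_exp_i_1[of x] by (simp add: cis_conv_exp)

lemma norm_cis_diff_le: "norm (cis x - cis y) \<le> \<bar>x - y\<bar>"
proof -
  have "cis x - cis y = cis y * (cis (x - y) - 1)"
    by (simp add: algebra_simps cis_mult)
  then have "norm (cis x - cis y) = 2 * \<bar>sin ((x - y) / 2)\<bar>"
    by (simp add: norm_mult norm_cis_minus_one)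
  then show ?thesis
    using abs_sin_x_le_abs_x[of "(x - y) / 2"] by simp
qed

text \<open>Jordan's inequality: the concave function \<open>sin\<close> lies above its chord over
  \<open>[0, \<pi> / 2]\<close>.\<close>

lemma sin_ge_chord:
  assumes "0 \<le> x" "x \<le> pi / 2"
  shows "sin x \<ge> 2 * x / pi"
proof -
  have "concave_on {0..pi/2} sin"
    by (rule f''_le0_imp_concave[where f' = cos and f'' = "\<lambda>x. - sin x"])
       (auto intro!: derivative_eq_intros sin_ge_zero)
  from concave_onD[OF this, of "2 * x / pi" 0 "pi / 2"] show ?thesis
    using assms by (simp add: field_simps)
qed

lemma abs_le_norm_cis_minus_one:
  assumes "\<bar>x\<bar> \<le> pi"
  shows "\<bar>x\<bar> \<le> pi / 2 * norm (cis x - 1)"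
proof -
  have "2 * (\<bar>x\<bar> / 2) / pi \<le> sin (\<bar>x\<bar> / 2)"
    using assms by (intro sin_ge_chord) auto
  also have "\<dots> \<le> \<bar>sin (x / 2)\<bar>"
    by (cases "x \<ge> 0") auto
  finally show ?thesis
    by (simp add: norm_cis_minus_one field_simps)
qed

text \<open>Moving both points radially to the smaller of the two circles does not increase their
  distance; there the chord controls the angle.\<close>

lemma angle_le_dist:
  assumes "0 \<le> r1" "0 \<le> r2" "\<bar>x\<bar> \<le> pi"
  shows "min r1 r2 * \<bar>x\<bar> \<le> pi / 2 * norm (of_real r1 * cis a - of_real r2 * cis (a + x))"
proof -
  define m where "m = min r1 r2"
  have m: "0 \<le> m" "m * m \<le> r1 * r2"
    using assms by (auto simp: m_def intro!: mult_mono)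
  have "(m * norm (cis x - 1))\<^sup>2 = 2 * (m * m) * (1 - cos x)"
  proof -
    have "(norm (cis x - 1))\<^sup>2 = (cos x - 1)\<^sup>2 + (sin x)\<^sup>2"
      by (simp add: cmod_power2)
    also have "\<dots> = 2 * (1 - cos x)"
      by (simp add: power2_diff sin_squared_eq)
    finally show ?thesis
      by (simp add: power_mult_distrib power2_eq_square)
  qed
  also have "\<dots> \<le> (r1 - r2)\<^sup>2 + 2 * (r1 * r2) * (1 - cos x)"
    using mult_right_mono[OF m(2), of "1 - cos x"] zero_le_power2[of "r1 - r2"] cos_le_one[of x]
    unfolding mult.assoc by linarith
  also have "\<dots> = (r1 - r2 * cos x)\<^sup>2 + r2\<^sup>2 * (sin x)\<^sup>2"
    by (simp add: sin_squared_eq power2_diff power_mult_distrib algebra_simps)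
  also have "\<dots> = (norm (of_real r1 - of_real r2 * cis x))\<^sup>2"
    by (simp add: cmod_power2 power_mult_distrib)
  also have "norm (of_real r1 - of_real r2 * cis x)
      = norm (of_real r1 * cis a - of_real r2 * cis (a + x))"
  proof -
    have "of_real r1 * cis a - of_real r2 * cis (a + x)
        = cis a * (of_real r1 - of_real r2 * cis x)"
      by (simp add: algebra_simps flip: cis_mult)
    then show ?thesis
      by (simp add: norm_mult)
  qed
  finally have chord: "m * norm (cis x - 1)
      \<le> norm (of_real r1 * cis a - of_real r2 * cis (a + x))"
    by (rule power2_le_imp_le) simp
  have "m * \<bar>x\<bar> \<le> m * (pi / 2 * norm (cis x - 1))"
    using m(1) by (intro mult_left_mono abs_le_norm_cis_minus_one assms)
  also have "\<dots> = pi / 2 * (m * norm (cis x - 1))"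
    by simp
  also have "\<dots> \<le> pi / 2 * norm (of_real r1 * cis a - of_real r2 * cis (a + x))"
    using chord by (intro mult_left_mono) auto
  finally show ?thesis
    unfolding m_def .
qed

lemma polar_pair_exists:
  fixes w1 w2 :: complex
  assumes "w1 \<noteq> 0" "w2 \<noteq> 0"
  obtains a x where "\<bar>x\<bar> \<le> pi" "w1 = of_real (norm w1) * cis a"
    "w2 = of_real (norm w2) * cis (a + x)"
proof (rule that[of "Arg (w2 / w1)" "Arg w1"])
  show "\<bar>Arg (w2 / w1)\<bar> \<le> pi"
    using Arg_bounded[of "w2 / w1"] by auto
  show "w1 = of_real (norm w1) * cis (Arg w1)"
    using assms by (simp add: cis_Arg sgn_eq)
  show "w2 = of_real (norm w2) * cis (Arg w1 + Arg (w2 / w1))"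
    using assms by (simp add: cis_Arg sgn_eq norm_divide field_simps flip: cis_mult)
qed

section \<open>The Hartogs triangle and its boundary\<close>

lemma open_hartogs_triangle: "open hartogs_triangle"
proof -
  have "hartogs_triangle = {p. cmod (fst p) < cmod (snd p)} \<inter> {p. cmod (snd p) < 1}"
    by (auto simp: hartogs_triangle_def)
  also have "open \<dots>"
    by (intro open_Int open_Collect_less continuous_intros)
  finally show ?thesis .
qed

text \<open>Both \<open>|w| - |z|\<close> and \<open>1 - |w|\<close> decrease by at most \<open>2 \<rho>\<close> over a distance \<open>\<rho>\<close>,
  and on the frontier one of them is not positive.\<close>

lemma hartogs_triangle_infdist_frontier:
  assumes "cmod w - cmod z \<ge> 2 * c" "1 - cmod w \<ge> 2 * c" "0 \<le> c"
    and ne: "frontier hartogs_triangle \<noteq> {}"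
  shows "infdist (z, w) (frontier hartogs_triangle) \<ge> c"
  unfolding infdist_notempty[OF ne]
proof (rule cINF_greatest[OF ne])
  fix q assume "q \<in> frontier hartogs_triangle"
  then have "q \<notin> hartogs_triangle"
    using frontier_disjoint_eq[of hartogs_triangle] open_hartogs_triangle by blast
  moreover obtain z' w' where q: "q = (z', w')"
    by (cases q)
  ultimately have "cmod w' \<le> cmod z' \<or> 1 \<le> cmod w'"
    by (auto simp: hartogs_triangle_def)
  moreover have "cmod (z - z') \<le> dist (z, w) q" "cmod (w - w') \<le> dist (z, w) q"
    unfolding q by (auto simp: dist_norm norm_fst_le norm_snd_le)
  moreover have "cmod z' - cmod z \<le> cmod (z - z')"
    by (metis norm_minus_commute norm_triangle_ineq2)
  moreover have "\<bar>cmod w - cmod w'\<bar> \<le> cmod (w - w')"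
    by (rule norm_triangle_ineq3)
  ultimately show "c \<le> dist (z, w) q"
    using assms by linarith
qed

section \<open>The joining curve\<close>

lemma convex_combination_bounds:
  fixes x y lo hi t :: real
  assumes "lo \<le> x" "x \<le> hi" "lo \<le> y" "y \<le> hi" "0 \<le> t" "t \<le> 1"
  shows "lo \<le> (1 - t) * x + t * y" "(1 - t) * x + t * y \<le> hi"
  using convex_bound_le[of x hi y "1 - t" t] convex_bound_le[of "-x" "-lo" "-y" "1 - t" t] assms
  by auto

lemma bump_lipschitz:
  fixes t t' :: real
  assumes "t \<in> {0..1}" "t' \<in> {0..1}"
  shows "\<bar>t * (1 - t) - t' * (1 - t')\<bar> \<le> \<bar>t - t'\<bar>"
proof -
  have "t * (1 - t) - t' * (1 - t') = (t - t') * (1 - t - t')"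
    by (simp add: algebra_simps)
  then have "\<bar>t * (1 - t) - t' * (1 - t')\<bar> = \<bar>t - t'\<bar> * \<bar>1 - t - t'\<bar>"
    by (simp add: abs_mult)
  also have "\<dots> \<le> \<bar>t - t'\<bar> * 1"
    using assms by (intro mult_left_mono) auto
  finally show ?thesis by simp
qed

lemma bump_bounds:
  fixes t :: real
  assumes "t \<in> {0..1}"
  shows "0 \<le> t * (1 - t)" "t * (1 - t) \<le> 1 / 4"
proof -
  show "0 \<le> t * (1 - t)"
    using assms by simp
  show "t * (1 - t) \<le> 1 / 4"
    using zero_le_square[of "t - 1/2"] by (simp add: algebra_simps)
qed

text \<open>The product rule for Lipschitz bounds, for the factor \<open>1 - s\<close> of the pull.\<close>

lemma scale_diff_le:
  fixes x y :: "'a::real_normed_vector"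
  assumes "0 \<le> s" "s \<le> 1" "norm (x - y) \<le> A" "\<bar>s - s'\<bar> \<le> B" "norm y \<le> C"
  shows "norm ((1 - s) *\<^sub>R x - (1 - s') *\<^sub>R y) \<le> A + B * C"
proof -
  have "(1 - s) *\<^sub>R x - (1 - s') *\<^sub>R y = (1 - s) *\<^sub>R (x - y) - (s - s') *\<^sub>R y"
    by (simp add: algebra_simps)
  also have "norm \<dots> \<le> norm ((1 - s) *\<^sub>R (x - y)) + norm ((s - s') *\<^sub>R y)"
    by (rule norm_triangle_ineq4)
  also have "\<dots> = (1 - s) * norm (x - y) + \<bar>s - s'\<bar> * norm y"
    using assms by simp
  also have "\<dots> \<le> 1 * A + B * C"
    using assms by (intro add_mono mult_mono) auto
  finally show ?thesis by simp
qed

text \<open>This curve does all the work. The factor \<open>t (1 - t)\<close> in the gaps makes them comparable with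
  the product of the distances to the two endpoints, which the Lipschitz condition bounds by
  multiples of \<open>t\<close> and of \<open>1 - t\<close>.\<close>

lemma hartogs_triangle_curve:
  assumes p1: "p1 \<in> hartogs_triangle" and p2: "p2 \<in> hartogs_triangle"
  shows "\<exists>g. (10 * dist p1 p2)-lipschitz_on {0..1} g \<and> g 0 = p1 \<and> g 1 = p2 \<and>
    (\<forall>t\<in>{0..1}. g t \<in> hartogs_triangle \<and>
      cmod (snd (g t)) - cmod (fst (g t)) \<ge> dist p1 p2 * (t * (1 - t)) / 2 \<and>
      1 - cmod (snd (g t)) \<ge> dist p1 p2 * (t * (1 - t)) / 2)"
proof -
  obtain z1 w1 where p1_eq: "p1 = (z1, w1)" by (cases p1)
  obtain z2 w2 where p2_eq: "p2 = (z2, w2)" by (cases p2)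
  define d r1 r2 where "d = dist p1 p2" and "r1 = cmod w1" and "r2 = cmod w2"
  have r1: "cmod z1 < r1" "r1 < 1" and r2: "cmod z2 < r2" "r2 < 1"
    using p1 p2 by (auto simp: p1_eq p2_eq r1_def r2_def hartogs_triangle_def)
  have pos: "0 < r1" "0 < r2"
    using r1(1) r2(1) norm_ge_zero[of z1] norm_ge_zero[of z2] by linarith+
  then have "w1 \<noteq> 0" "w2 \<noteq> 0"
    by (auto simp: r1_def r2_def)
  then obtain a x where x: "\<bar>x\<bar> \<le> pi" and w1: "w1 = of_real r1 * cis a"
    and w2: "w2 = of_real r2 * cis (a + x)"
    unfolding r1_def r2_def by (rule polar_pair_exists)
  have d0: "0 \<le> d"
    by (simp add: d_def)
  have dz: "cmod (z1 - z2) \<le> d" and dw: "cmod (w1 - w2) \<le> d"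
    by (auto simp: d_def p1_eq p2_eq dist_norm norm_fst_le norm_snd_le)
  have dr: "\<bar>r1 - r2\<bar> \<le> d"
    unfolding r1_def r2_def using norm_triangle_ineq3[of w1 w2] dw by linarith
  have "d \<le> cmod (z1 - z2) + cmod (w1 - w2)"
    by (simp add: d_def p1_eq p2_eq dist_norm norm_Pair_le)
  also have "\<dots> \<le> cmod z1 + cmod z2 + (cmod w1 + cmod w2)"
    by (intro add_mono norm_triangle_ineq4)
  finally have d4: "d < 4"
    using r1 r2 by (simp add: r1_def r2_def)

  define s where "s t = d * (t * (1 - t))" for t
  define Z where "Z t = (1 - t) *\<^sub>R z1 + t *\<^sub>R z2" for t
  define r where "r t = (1 - t) * r1 + t * r2" for t
  define \<rho> where "\<rho> t = (1 - s t) * r t + s t / 2" for t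
  define g where "g t = ((1 - s t) *\<^sub>R Z t, of_real (\<rho> t) * cis (a + t * x))" for t

  have s: "0 \<le> s t" "s t \<le> d / 4" "s t < 1" if "t \<in> {0..1}" for t
  proof -
    show "0 \<le> s t"
      unfolding s_def using bump_bounds[OF that] d0 by simp
    show "s t \<le> d / 4"
      unfolding s_def using mult_left_mono[OF bump_bounds(2)[OF that] d0] by simp
    then show "s t < 1"
      using d4 by simp
  qed
  have Zr: "cmod (Z t) < r t" if "t \<in> {0..1}" for t
  proof -
    have "cmod (Z t) \<le> (1 - t) * cmod z1 + t * cmod z2"
      unfolding Z_def using that norm_triangle_ineq[of "(1 - t) *\<^sub>R z1" "t *\<^sub>R z2"] by simp
    also have "\<dots> < (1 - t) * r1 + t * r2"
    proof (cases "t = 1")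
      case False
      then show ?thesis
        using that r1 r2 by (intro add_less_le_mono mult_strict_left_mono mult_left_mono) auto
    qed (use r2 in simp)
    finally show ?thesis
      by (simp add: r_def)
  qed
  have r_less_1: "r t < 1" if "t \<in> {0..1}" for t
    unfolding r_def using that r1 r2 by (intro convex_bound_lt) auto
  have r_le: "r t \<le> max r1 r2" if "t \<in> {0..1}" for t
    unfolding r_def using that by (intro convex_combination_bounds(2)[of "min r1 r2"]) auto
  have r_nonneg: "0 \<le> r t" if "t \<in> {0..1}" for t
    using Zr[OF that] norm_ge_zero[of "Z t"] by linarith
  have \<rho>_nonneg: "0 \<le> \<rho> t" if "t \<in> {0..1}" for t
    using s[OF that] r_nonneg[OF that] by (simp add: \<rho>_def)
  have norms: "cmod (fst (g t)) = (1 - s t) * cmod (Z t)" "cmod (snd (g t)) = \<rho> t"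
    if "t \<in> {0..1}" for t
    using s[OF that] \<rho>_nonneg[OF that] by (auto simp: g_def norm_mult)

  have gap_zw: "cmod (snd (g t)) - cmod (fst (g t)) > s t / 2" if "t \<in> {0..1}" for t
  proof -
    have "0 < (1 - s t) * (r t - cmod (Z t))"
      using s[OF that] Zr[OF that] by (intro mult_pos_pos) auto
    then show ?thesis
      by (simp add: norms[OF that] \<rho>_def algebra_simps)
  qed
  have gap_w: "1 - cmod (snd (g t)) > s t / 2" if "t \<in> {0..1}" for t
  proof -
    have "0 < (1 - s t) * (1 - r t)"
      using s[OF that] r_less_1[OF that] by (intro mult_pos_pos) auto
    then show ?thesis
      by (simp add: norms[OF that] \<rho>_def algebra_simps)
  qed

  \<comment> \<open>The larger radius may turn through a large angle without a large chord only if the smaller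
    radius is itself small, and then both radii are of order \<open>d\<close>.\<close>
  have \<rho>_angle: "\<rho> t * \<bar>x\<bar> \<le> 6 * d" if "t \<in> {0..1}" for t
  proof -
    have "(1 - s t) * r t \<le> 1 * r t"
      using s[OF that] r_nonneg[OF that] by (intro mult_right_mono) auto
    then have "\<rho> t \<le> min r1 r2 + 9 / 8 * d"
      using r_le[OF that] s[OF that] dr by (simp add: \<rho>_def)
    then have "\<rho> t * \<bar>x\<bar> \<le> (min r1 r2 + 9 / 8 * d) * \<bar>x\<bar>"
      by (intro mult_right_mono) auto
    also have "\<dots> = min r1 r2 * \<bar>x\<bar> + 9 / 8 * d * \<bar>x\<bar>"
      by (simp add: algebra_simps)
    also have "\<dots> \<le> pi / 2 * d + 9 / 8 * d * pi"
    proof (intro add_mono)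
      have "min r1 r2 * \<bar>x\<bar> \<le> pi / 2 * cmod (w1 - w2)"
        unfolding w1 w2 using pos x by (intro angle_le_dist) auto
      also have "\<dots> \<le> pi / 2 * d"
        using dw by (intro mult_left_mono) auto
      finally show "min r1 r2 * \<bar>x\<bar> \<le> pi / 2 * d" .
    qed (use d0 x in \<open>auto intro!: mult_left_mono\<close>)
    also have "\<dots> = 13 / 8 * pi * d"
      by (simp add: algebra_simps)
    also have "\<dots> \<le> 6 * d"
      using d0 pi_approx by (intro mult_right_mono) auto
    finally show ?thesis .
  qed

  have lip: "dist (g t) (g t') \<le> 10 * d * dist t t'" if t: "t \<in> {0..1}" and t': "t' \<in> {0..1}" for t t'
  proof -
    define h where "h = \<bar>t - t'\<bar>"
    have ds: "\<bar>s t - s t'\<bar> \<le> d * h"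
    proof -
      have "\<bar>s t - s t'\<bar> = d * \<bar>t * (1 - t) - t' * (1 - t')\<bar>"
        using d0 by (simp add: s_def abs_mult flip: right_diff_distrib)
      then show ?thesis
        using mult_left_mono[OF bump_lipschitz[OF t t'] d0] by (simp add: h_def)
    qed
    have dZ: "cmod (Z t - Z t') \<le> d * h"
    proof -
      have "Z t - Z t' = (t' - t) *\<^sub>R (z1 - z2)"
        by (simp add: Z_def algebra_simps)
      then have "cmod (Z t - Z t') = h * cmod (z1 - z2)"
        by (simp add: h_def abs_minus_commute)
      also have "\<dots> \<le> h * d"
        using dz by (intro mult_left_mono) (auto simp: h_def)
      finally show ?thesis by (simp add: mult.commute)
    qed
    have dr': "\<bar>r t - r t'\<bar> \<le> d * h"
    proof -
      have "r t - r t' = (t' - t) * (r1 - r2)"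
        by (simp add: r_def algebra_simps)
      then have "\<bar>r t - r t'\<bar> = h * \<bar>r1 - r2\<bar>"
        by (simp add: h_def abs_mult abs_minus_commute)
      also have "\<dots> \<le> h * d"
        using dr by (intro mult_left_mono) (auto simp: h_def)
      finally show ?thesis by (simp add: mult.commute)
    qed
    have "cmod ((1 - s t) *\<^sub>R Z t - (1 - s t') *\<^sub>R Z t') \<le> d * h + d * h * 1"
      using s[OF t] dZ ds Zr[OF t'] r_less_1[OF t'] by (intro scale_diff_le) auto
    then have fst_le: "cmod (fst (g t) - fst (g t')) \<le> 2 * d * h"
      by (simp add: g_def)
    have d\<rho>: "\<bar>\<rho> t - \<rho> t'\<bar> \<le> 3 / 2 * d * h"
    proof -
      \<comment> \<open>Up to the constant \<open>1 / 2\<close>, the modulus \<open>\<rho>\<close> is \<open>r - 1 / 2\<close> scaled by \<open>1 - s\<close>.\<close>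
      have "norm ((1 - s t) *\<^sub>R (r t - 1/2) - (1 - s t') *\<^sub>R (r t' - 1/2)) \<le> d * h + d * h * (1/2)"
      proof (rule scale_diff_le)
        show "norm (r t' - 1/2) \<le> 1/2"
          using r_nonneg[OF t'] r_less_1[OF t'] by (simp only: real_norm_def abs_le_iff) linarith
      qed (use s[OF t] dr' ds in auto)
      moreover have "\<rho> t - \<rho> t' = (1 - s t) *\<^sub>R (r t - 1/2) - (1 - s t') *\<^sub>R (r t' - 1/2)"
        by (simp add: \<rho>_def field_simps)
      ultimately show ?thesis by simp
    qed
    have "snd (g t) - snd (g t') =
        of_real (\<rho> t - \<rho> t') * cis (a + t * x)
        + of_real (\<rho> t') * (cis (a + t * x) - cis (a + t' * x))"
      by (simp add: g_def algebra_simps)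
    also have "cmod \<dots> \<le> \<bar>\<rho> t - \<rho> t'\<bar> + \<rho> t' * cmod (cis (a + t * x) - cis (a + t' * x))"
      by (rule order_trans[OF norm_triangle_ineq])
         (use \<rho>_nonneg[OF t'] in \<open>simp add: norm_mult del: of_real_diff\<close>)
    also have "\<dots> \<le> 3 / 2 * d * h + 6 * d * h"
    proof (intro add_mono d\<rho>)
      have "cmod (cis (a + t * x) - cis (a + t' * x)) \<le> \<bar>t * x - t' * x\<bar>"
        using norm_cis_diff_le[of "a + t * x" "a + t' * x"] by simp
      also have "\<dots> = \<bar>x\<bar> * h"
        by (simp add: h_def abs_mult mult.commute flip: left_diff_distrib)
      finally have "\<rho> t' * cmod (cis (a + t * x) - cis (a + t' * x)) \<le> \<rho> t' * (\<bar>x\<bar> * h)"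
        using \<rho>_nonneg[OF t'] by (intro mult_left_mono) auto
      also have "\<dots> = \<rho> t' * \<bar>x\<bar> * h"
        by simp
      also have "\<dots> \<le> 6 * d * h"
        using \<rho>_angle[OF t'] by (intro mult_right_mono) (auto simp: h_def)
      finally show "\<rho> t' * cmod (cis (a + t * x) - cis (a + t' * x)) \<le> 6 * d * h" .
    qed
    finally have snd_le: "cmod (snd (g t) - snd (g t')) \<le> 3 / 2 * d * h + 6 * d * h" .
    have "dist (g t) (g t') = norm (fst (g t) - fst (g t'), snd (g t) - snd (g t'))"
      by (simp add: dist_norm minus_prod_def)
    also have "\<dots> \<le> cmod (fst (g t) - fst (g t')) + cmod (snd (g t) - snd (g t'))"
      by (rule norm_Pair_le)
    also have "\<dots> \<le> 2 * d * h + (3 / 2 * d * h + 6 * d * h)"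
      using fst_le snd_le by (rule add_mono)
    also have "\<dots> \<le> 10 * d * h"
      using d0 by (simp add: h_def mult.assoc)
    finally show ?thesis
      by (simp add: h_def dist_real_def)
  qed

  show ?thesis
  proof (intro exI[of _ g] conjI ballI)
    show "(10 * dist p1 p2)-lipschitz_on {0..1} g"
      using lip d0 by (intro lipschitz_onI) (auto simp: d_def)
    show "g 0 = p1" "g 1 = p2"
      using w1 w2 by (auto simp: g_def s_def Z_def \<rho>_def r_def p1_eq p2_eq)
    show "g t \<in> hartogs_triangle" if "t \<in> {0..1}" for t
      using gap_zw[OF that] gap_w[OF that] s(1)[OF that]
      by (auto simp: hartogs_triangle_def case_prod_beta)
    show "cmod (snd (g t)) - cmod (fst (g t)) \<ge> dist p1 p2 * (t * (1 - t)) / 2"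
      if "t \<in> {0..1}" for t
      using gap_zw[OF that] by (simp add: s_def d_def)
    show "1 - cmod (snd (g t)) \<ge> dist p1 p2 * (t * (1 - t)) / 2" if "t \<in> {0..1}" for t
      using gap_w[OF that] by (simp add: s_def d_def)
  qed
qed

lemma is_domain_hartogs_triangle: "is_domain hartogs_triangle"
proof -
  have "path_connected hartogs_triangle"
    unfolding path_connected_def
  proof (intro ballI)
    fix p1 p2 assume p: "p1 \<in> hartogs_triangle" "p2 \<in> hartogs_triangle"
    obtain g :: "real \<Rightarrow> complex \<times> complex" where
      g: "(10 * dist p1 p2)-lipschitz_on {0..1} g" "g 0 = p1" "g 1 = p2"
      "\<And>t. t \<in> {0..1} \<Longrightarrow> g t \<in> hartogs_triangle"
      using hartogs_triangle_curve[OF p] by blast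
    then show "\<exists>g. path g \<and> path_image g \<subseteq> hartogs_triangle \<and> pathstart g = p1 \<and> pathfinish g = p2"
      using lipschitz_imp_rectifiable_curve[OF g(1)]
      by (intro exI[of _ g])
         (auto simp: rectifiable_curve_def path_image_def pathstart_def pathfinish_def)
  qed
  moreover have "(0, 1/2) \<in> hartogs_triangle"
    by (simp add: hartogs_triangle_def norm_divide)
  ultimately show ?thesis
    unfolding is_domain_def
    using open_hartogs_triangle path_connected_imp_connected by blast
qed

theorem theorem2p4:
  shows "uniform_domain hartogs_triangle"
proof -
  have "\<exists>g. rectifiable_curve g \<and> path_image g \<subseteq> hartogs_triangle \<and>
      pathstart g = p1 \<and> pathfinish g = p2 \<and>
      curve_length g \<le> ennreal (1 / (1/400) * dist p1 p2) \<and>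
      (frontier hartogs_triangle \<noteq> {} \<longrightarrow> (\<forall>p\<in>path_image g.
        infdist p (frontier hartogs_triangle) \<ge> 1/400 * dist p p1 * dist p p2 / dist p1 p2))"
    if p: "p1 \<in> hartogs_triangle" "p2 \<in> hartogs_triangle" "p1 \<noteq> p2" for p1 p2
  proof -
    define d where "d = dist p1 p2"
    have d: "d > 0"
      using p by (simp add: d_def)
    obtain g where lip: "(10 * d)-lipschitz_on {0..1} g" and ends: "g 0 = p1" "g 1 = p2"
      and mem: "\<And>t. t \<in> {0..1} \<Longrightarrow> g t \<in> hartogs_triangle"
      and gaps: "\<And>t. t \<in> {0..1} \<Longrightarrow> cmod (snd (g t)) - cmod (fst (g t)) \<ge> d * (t * (1 - t)) / 2"
        "\<And>t. t \<in> {0..1} \<Longrightarrow> 1 - cmod (snd (g t)) \<ge> d * (t * (1 - t)) / 2"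
      unfolding d_def using hartogs_triangle_curve[OF p(1,2)] by blast
    have len: "curve_length g \<le> ennreal (1 / (1/400) * d)"
      using lipschitz_curve_length_le[OF lip] d by (auto intro: order_trans ennreal_leI)
    have far: "infdist (g t) (frontier hartogs_triangle) \<ge> 1/400 * dist (g t) p1 * dist (g t) p2 / d"
      if ne: "frontier hartogs_triangle \<noteq> {}" and t: "t \<in> {0..1}" for t
    proof -
      have "dist (g t) p1 \<le> 10 * d * t" "dist (g t) p2 \<le> 10 * d * (1 - t)"
        using lipschitz_onD[OF lip t, of 0] lipschitz_onD[OF lip t, of 1] t ends
        by (auto simp: dist_real_def)
      then have "dist (g t) p1 * dist (g t) p2 \<le> (10 * d * t) * (10 * d * (1 - t))"
        using d t by (intro mult_mono) auto
      then have "1/400 * dist (g t) p1 * dist (g t) p2 / d \<le> d * (t * (1 - t)) / 4"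
        using d by (simp add: field_simps)
      also have "\<dots> \<le> infdist (fst (g t), snd (g t)) (frontier hartogs_triangle)"
        using gaps[OF t] bump_bounds(1)[OF t] d ne
        by (intro hartogs_triangle_infdist_frontier) auto
      finally show ?thesis by simp
    qed
    show ?thesis
      using lipschitz_imp_rectifiable_curve[OF lip] ends mem len far
      by (intro exI[of _ g]) (auto simp: path_image_def pathstart_def pathfinish_def d_def)
  qed
  then have "eps_delta_domain (1/400) \<infinity> hartogs_triangle"
    unfolding eps_delta_domain_def using is_domain_hartogs_triangle by auto
  then show ?thesis
    unfolding uniform_domain_def by (intro exI[of _ "1/400"]) auto
qed

end
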